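(* Let $N\ge 1$, let $J\in\mathbb{R}^{2N\times 2N}$ be nonsingular and skew-symmetric, and let $W\in\mathbb{R}^{2N\times 2N}$ be $J$-symplectic. If $W$ is strongly stable, then there exists a constant $\delta>0$ such that for every vector $u\in\mathbb{R}^{2N}$ with $\|uu^TJW\|<\delta$, the matrix $\widetilde{W}=(I+uu^TJ)W$ is stable.
   Context: A matrix $W\in\mathbb{R}^{2N\times 2N}$ is $J$-symplectic if $W^TJW=J$. $\|\cdot\|$ is the matrix 2-norm. A $J$-symplectic matrix $W$ is stable if its powers $W^k$, $k\in\mathbb{Z}$, are uniformly bounded in norm; it is strongly stable if there exists $\delta_0>0$ such that every $J$-symplectic $W'\in\mathbb{R}^{2N\times 2N}$ with $\|W'-W\|\le\delta_0$ is stable. *)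

theory Defs
  imports "HOL-Analysis.Analysis"
begin

text \<open>The operator norm subordinate to the Euclidean norm; the type-class norm on
  \<^typ>\<open>real^'n^'n\<close> is the Frobenius norm.\<close>

definition matrix_2norm :: "real^'n^'m \<Rightarrow> real" where
  "matrix_2norm A = onorm (\<lambda>x. A *v x)"

definition outer_product :: "real^'m \<Rightarrow> real^'n \<Rightarrow> real^'n^'m" where
  "outer_product u v = (columnvector u :: real^1^'m) ** (rowvector v :: real^'n^1)"

text \<open>Powers with respect to the matrix product; the type-class multiplication on
  \<^typ>\<open>real^'n^'n\<close> is componentwise.\<close>

primrec matrix_power :: "real^'n^'n \<Rightarrow> nat \<Rightarrow> real^'n^'n" where
  "matrix_power A 0 = mat 1"
| "matrix_power A (Suc k) = A ** matrix_power A k"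

definition matrix_power_int :: "real^'n^'n \<Rightarrow> int \<Rightarrow> real^'n^'n" where
  "matrix_power_int A k =
     (if k \<ge> 0 then matrix_power A (nat k) else matrix_power (matrix_inv A) (nat (- k)))"

definition symplectic :: "real^'n^'n \<Rightarrow> real^'n^'n \<Rightarrow> bool" where
  "symplectic J W \<longleftrightarrow> transpose W ** J ** W = J"

definition symplectic_stable :: "real^'n^'n \<Rightarrow> real^'n^'n \<Rightarrow> bool" where
  "symplectic_stable J W \<longleftrightarrow>
     symplectic J W \<and> (\<exists>C. \<forall>k::int. matrix_2norm (matrix_power_int W k) \<le> C)"

definition strongly_stable :: "real^'n^'n \<Rightarrow> real^'n^'n \<Rightarrow> bool" where
  "strongly_stable J W \<longleftrightarrow>
     symplectic J W \<and>
     (\<exists>\<delta>\<^sub>0>0. \<forall>W'. symplectic J W' \<and> matrix_2norm (W' - W) \<le> \<delta>\<^sub>0 \<longrightarrow> symplectic_stable J W')"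

end

theory Submission
  imports Defs
begin

text \<open>A transvection \<open>I + u u\<^sup>T J\<close> is itself symplectic, because \<open>u\<^sup>T J u = 0\<close> for skew-symmetric
  \<open>J\<close>; and \<open>(I + u u\<^sup>T J) W\<close> differs from \<open>W\<close> by exactly \<open>u u\<^sup>T J W\<close>. So the strong stability
  radius of \<open>W\<close> serves as \<open>\<delta>\<close>.\<close>

lemma transpose_add: "transpose (A + B) = transpose A + transpose (B :: real^'n^'m)"
  by (simp add: transpose_def vec_eq_iff)

lemma matrix_mul_minus_right: "A ** (- B) = - (A ** B)" for A :: "real^'n^'m" and B :: "real^'p^'n"
  by (simp add: matrix_matrix_mult_def vec_eq_iff sum_negf)

lemma matrix_mul_minus_left: "(- A) ** B = - (A ** B)" for A :: "real^'n^'m" and B :: "real^'p^'n"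
  by (simp add: matrix_matrix_mult_def vec_eq_iff sum_negf)

lemma matrix_add_rdistrib: "(A + B) ** C = A ** C + B ** C" for A B :: "real^'n^'m" and C :: "real^'p^'n"
  by (simp add: matrix_matrix_mult_def vec_eq_iff sum.distrib distrib_right)

lemma transpose_outer_product: "transpose (outer_product u v) = outer_product v u"
  unfolding outer_product_def by (simp add: matrix_transpose_mul transpose_columnvector transpose_rowvector)

text \<open>Transposing the product reverses its factors and flips its sign by skewness, yet a 1 by
  1 matrix is its own transpose.\<close>

lemma skew_form_self_eq_0:
  fixes J :: "real^'n^'n" and u :: "real^'n"
  assumes "transpose J = - J"
  shows "(rowvector u :: real^'n^1) ** J ** (columnvector u :: real^1^'n) = 0" (is "?m = 0")
proof -
  have "transpose ?m = - ?m"
    by (simp add: matrix_transpose_mul assms matrix_mul_minus_left matrix_mul_minus_right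
        matrix_mul_assoc transpose_columnvector transpose_rowvector)
  \<comment> \<open>The index type \<open>1\<close> has a single element, so swapping the two
    indices changes nothing.\<close>
  moreover have "transpose ?m = ?m"
    by (simp add: transpose_def vec_eq_iff)
  ultimately have "?m = - ?m"
    by simp
  then have "?m $ i $ j = - ?m $ i $ j" for i j
    by (metis vector_uminus_component)
  then show ?thesis
    by (simp add: vec_eq_iff)
qed

text \<open>Reassociating puts the vanishing 1 by 1 matrix u^T J u in the middle. This disposes of
  the quadratic term when a transvection is tested for symplecticity.\<close>

lemma outer_product_skew_outer_product:
  fixes J :: "real^'n^'n"
  assumes "transpose J = - J"
  shows "outer_product u u ** J ** outer_product u u = 0"
proof -
  have "outer_product u u ** J ** outer_product u u =
      (columnvector u :: real^1^'n) **
      ((rowvector u :: real^'n^1) ** J ** (columnvector u :: real^1^'n)) ** (rowvector u :: real^'n^1)"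
    unfolding outer_product_def by (simp add: matrix_mul_assoc)
  then show ?thesis
    by (simp add: skew_form_self_eq_0 [OF assms] times0_left times0_right)
qed

lemma symplectic_transvection:
  assumes "transpose J = - J"
  shows "symplectic J (mat 1 + outer_product u u ** J)"
proof -
  let ?P = "outer_product u u"
  have "transpose (mat 1 + ?P ** J) = mat 1 - J ** ?P"
    by (simp add: transpose_add matrix_transpose_mul transpose_outer_product assms
        matrix_mul_minus_left)
  \<comment> \<open>The two terms linear in \<open>?P\<close> are \<open>J ** ?P ** J\<close> with
    opposite signs and cancel. Differences are kept as sums with a negated term so that the
    distributive laws for addition apply.\<close>
  then have "transpose (mat 1 + ?P ** J) ** J ** (mat 1 + ?P ** J) =
      J - J ** (?P ** J ** ?P) ** J"
    by (simp add: diff_conv_add_uminus matrix_add_ldistrib matrix_add_rdistrib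
        matrix_mul_minus_left matrix_mul_assoc del: add_uminus_conv_diff)
  also have "\<dots> = J"
    by (simp add: outer_product_skew_outer_product [OF assms] times0_left times0_right)
  finally show ?thesis
    unfolding symplectic_def .
qed

text \<open>Regroup (AB)^T J (AB) as B^T (A^T J A) B and collapse from the inside out.\<close>

lemma symplectic_mult:
  assumes "symplectic J A" "symplectic J B"
  shows "symplectic J (A ** B)"
  using assms unfolding symplectic_def by (metis matrix_mul_assoc matrix_transpose_mul)

theorem proposition16:
  fixes N :: nat and J W :: "real^'n^'n"
  assumes "N \<ge> 1" and "CARD('n) = 2 * N"
    and "invertible J" and "transpose J = - J"
    and "symplectic J W"
    and "strongly_stable J W"
  shows "\<exists>\<delta>>0. \<forall>u :: real^'n.
           matrix_2norm (outer_product u u ** J ** W) < \<delta> \<longrightarrow>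
           symplectic_stable J ((mat 1 + outer_product u u ** J) ** W)"
proof -
  obtain \<delta> where "\<delta> > 0" and stable:
    "\<And>W'. symplectic J W' \<Longrightarrow> matrix_2norm (W' - W) \<le> \<delta> \<Longrightarrow> symplectic_stable J W'"
    using assms(6) unfolding strongly_stable_def by blast
  have "symplectic_stable J ((mat 1 + outer_product u u ** J) ** W)"
    if "matrix_2norm (outer_product u u ** J ** W) < \<delta>" for u
  proof (rule stable)
    show "symplectic J ((mat 1 + outer_product u u ** J) ** W)"
      using assms(4,5) by (intro symplectic_mult symplectic_transvection)
    have "(mat 1 + outer_product u u ** J) ** W - W = outer_product u u ** J ** W"
      by (simp add: matrix_add_rdistrib)
    \<comment> \<open>The stability ball is closed and the assumed bound strict, so the radius need
      not be shrunk.\<close>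
    then show "matrix_2norm ((mat 1 + outer_product u u ** J) ** W - W) \<le> \<delta>"
      using that by simp
  qed
  with \<open>\<delta> > 0\<close> show ?thesis
    by blast
qed

end
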